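(* The canonical full and faithful functor $\mathrm{CPM}[\mathbf{Rel}]^{\oplus}\to\mathrm{CP}^*[\mathbf{Rel}]$ is not an equivalence of categories; in fact, there is no equivalence of categories between $\mathrm{CPM}[\mathbf{Rel}]^{\oplus}$ and $\mathrm{CP}^*[\mathbf{Rel}]$.
   Context: $\mathbf{Rel}$ is the category of sets and relations, with relational composition. $\mathrm{CP}^*[\mathbf{Rel}]$: objects are small groupoids; morphisms $\mathbf{G}\to\mathbf{H}$ are relations $R\subseteq\mathrm{Mor}(\mathbf{G})\times\mathrm{Mor}(\mathbf{H})$ such that $gRh$ implies $g^{-1}Rh^{-1}$ and $1_{\mathrm{dom}(g)}\,R\,1_{\mathrm{dom}(h)}$. Composition and identities are those of $\mathbf{Rel}$. Biproducts are given by disjoint unions of groupoids. $\mathrm{CPM}[\mathbf{Rel}]$: objects are sets; morphisms $X\to Y$ are relations $R\colon X\times X\to Y\times Y$ such that $(x,x')R(y,y')$ implies $(x',x)R(y',y)$ and $(x,x)R(y,y)$. Composition and identities are those of $\mathbf{Rel}$; it is enriched over commutative monoids via union of relations. It is identified with the full subcategory of $\mathrm{CP}^*[\mathbf{Rel}]$ on the indiscrete groupoids (those with exactly one morphism between any two objects), a set $X$ corresponding to the indiscrete groupoid with object set $X$ and morphism set $X\times X$. $\mathbf{C}^{\oplus}$ is the (free, finite) biproduct completion of a category $\mathbf{C}$ enriched over commutative monoids: objects are finite tuples of objects of $\mathbf{C}$, morphisms are matrices of morphisms of $\mathbf{C}$, composed by matrix multiplication. The canonical functor $\mathrm{CPM}[\mathbf{Rel}]^{\oplus}\to\mathrm{CP}^*[\mathbf{Rel}]$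 is the biproduct-preserving extension of the inclusion of $\mathrm{CPM}[\mathbf{Rel}]$: it sends $(X_1,\dots,X_n)$ to the disjoint union of the indiscrete groupoids on $X_1,\dots,X_n$, and a matrix of relations to the corresponding relation between the disjoint unions of the morphism sets. *)

theory Defs
  imports "HOL-Library.Equipollence" "Jordan_Normal_Form.Matrix"
begin

section \<open>Categories, functors, equivalences\<close>

text \<open>Values of the operations outside their domain of definition are unspecified;
  \<open>Comp C g f\<close> is the composite \<open>g \<circ> f\<close>.\<close>

record ('o, 'a) cat =
  Obj :: "'o set"
  Arr :: "'a set"
  Dom :: "'a \<Rightarrow> 'o"
  Cod :: "'a \<Rightarrow> 'o"
  Id :: "'o \<Rightarrow> 'a"
  Comp :: "'a \<Rightarrow> 'a \<Rightarrow> 'a"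

definition Hom :: "('o, 'a, 'z) cat_scheme \<Rightarrow> 'o \<Rightarrow> 'o \<Rightarrow> 'a set" where
  "Hom C A B = {f \<in> Arr C. Dom C f = A \<and> Cod C f = B}"

locale category =
  fixes C :: "('o, 'a, 'z) cat_scheme"
  assumes Dom_in_Obj: "f \<in> Arr C \<Longrightarrow> Dom C f \<in> Obj C"
    and Cod_in_Obj: "f \<in> Arr C \<Longrightarrow> Cod C f \<in> Obj C"
    and Id_in_Hom: "A \<in> Obj C \<Longrightarrow> Id C A \<in> Hom C A A"
    and Comp_in_Hom: "f \<in> Arr C \<Longrightarrow> g \<in> Arr C \<Longrightarrow> Cod C f = Dom C g \<Longrightarrow>
      Comp C g f \<in> Hom C (Dom C f) (Cod C g)"
    and Comp_Id_right: "f \<in> Arr C \<Longrightarrow> Comp C f (Id C (Dom C f)) = f"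
    and Comp_Id_left: "f \<in> Arr C \<Longrightarrow> Comp C (Id C (Cod C f)) f = f"
    and Comp_assoc: "f \<in> Arr C \<Longrightarrow> g \<in> Arr C \<Longrightarrow> h \<in> Arr C \<Longrightarrow>
      Cod C f = Dom C g \<Longrightarrow> Cod C g = Dom C h \<Longrightarrow>
      Comp C h (Comp C g f) = Comp C (Comp C h g) f"

definition inverse_arrows :: "('o, 'a, 'z) cat_scheme \<Rightarrow> 'a \<Rightarrow> 'a \<Rightarrow> bool" where
  "inverse_arrows C f g \<longleftrightarrow>
     f \<in> Arr C \<and> g \<in> Hom C (Cod C f) (Dom C f) \<and>
     Comp C g f = Id C (Dom C f) \<and> Comp C f g = Id C (Cod C f)"

definition iso_arrow :: "('o, 'a, 'z) cat_scheme \<Rightarrow> 'a \<Rightarrow> bool" where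
  "iso_arrow C f \<longleftrightarrow> (\<exists>g. inverse_arrows C f g)"

definition Inv :: "('o, 'a, 'z) cat_scheme \<Rightarrow> 'a \<Rightarrow> 'a" where
  "Inv C f = (THE g. inverse_arrows C f g)"

record ('o, 'a, 'p, 'b) func =
  OMap :: "'o \<Rightarrow> 'p"
  AMap :: "'a \<Rightarrow> 'b"

definition is_functor ::
  "('o, 'a, 'y) cat_scheme \<Rightarrow> ('p, 'b, 'z) cat_scheme \<Rightarrow> ('o, 'a, 'p, 'b) func \<Rightarrow> bool" where
  "is_functor C D F \<longleftrightarrow>
     category C \<and> category D \<and>
     (\<forall>A \<in> Obj C. OMap F A \<in> Obj D) \<and>
     (\<forall>f \<in> Arr C. AMap F f \<in> Hom D (OMap F (Dom C f)) (OMap F (Cod C f))) \<and>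
     (\<forall>A \<in> Obj C. AMap F (Id C A) = Id D (OMap F A)) \<and>
     (\<forall>f \<in> Arr C. \<forall>g \<in> Arr C. Cod C f = Dom C g \<longrightarrow>
        AMap F (Comp C g f) = Comp D (AMap F g) (AMap F f))"

definition full ::
  "('o, 'a, 'y) cat_scheme \<Rightarrow> ('p, 'b, 'z) cat_scheme \<Rightarrow> ('o, 'a, 'p, 'b) func \<Rightarrow> bool" where
  "full C D F \<longleftrightarrow> (\<forall>A \<in> Obj C. \<forall>B \<in> Obj C.
     \<forall>g \<in> Hom D (OMap F A) (OMap F B). \<exists>f \<in> Hom C A B. AMap F f = g)"

definition faithful :: "('o, 'a, 'y) cat_scheme \<Rightarrow> ('o, 'a, 'p, 'b) func \<Rightarrow> bool" where
  "faithful C F \<longleftrightarrow> (\<forall>A \<in> Obj C. \<forall>B \<in> Obj C. inj_on (AMap F) (Hom C A B))"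

definition id_func :: "('o, 'a, 'o, 'a) func" where
  "id_func = \<lparr>OMap = (\<lambda>A. A), AMap = (\<lambda>f. f)\<rparr>"

definition comp_func ::
  "('p, 'b, 'q, 'c) func \<Rightarrow> ('o, 'a, 'p, 'b) func \<Rightarrow> ('o, 'a, 'q, 'c) func" where
  "comp_func G F = \<lparr>OMap = OMap G \<circ> OMap F, AMap = AMap G \<circ> AMap F\<rparr>"

definition naturally_isomorphic ::
  "('o, 'a, 'y) cat_scheme \<Rightarrow> ('p, 'b, 'z) cat_scheme \<Rightarrow>
   ('o, 'a, 'p, 'b) func \<Rightarrow> ('o, 'a, 'p, 'b) func \<Rightarrow> bool" where
  "naturally_isomorphic C D F G \<longleftrightarrow> (\<exists>\<tau>.
     (\<forall>A \<in> Obj C. \<tau> A \<in> Hom D (OMap F A) (OMap G A) \<and> iso_arrow D (\<tau> A)) \<and>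
     (\<forall>f \<in> Arr C.
        Comp D (\<tau> (Cod C f)) (AMap F f) = Comp D (AMap G f) (\<tau> (Dom C f))))"

definition is_equivalence ::
  "('o, 'a, 'y) cat_scheme \<Rightarrow> ('p, 'b, 'z) cat_scheme \<Rightarrow> ('o, 'a, 'p, 'b) func \<Rightarrow> bool" where
  "is_equivalence C D F \<longleftrightarrow> is_functor C D F \<and>
     (\<exists>G. is_functor D C G \<and>
        naturally_isomorphic C C (comp_func G F) id_func \<and>
        naturally_isomorphic D D (comp_func F G) id_func)"

section \<open>Groupoids\<close>

definition groupoid :: "('o, 'a, 'z) cat_scheme \<Rightarrow> bool" where
  "groupoid G \<longleftrightarrow> category G \<and> (\<forall>f \<in> Arr G. iso_arrow G f)"

definition indiscrete :: "'x set \<Rightarrow> ('x, 'x \<times> 'x) cat" where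
  "indiscrete X =
     \<lparr>Obj = X, Arr = X \<times> X, Dom = fst, Cod = snd,
      Id = (\<lambda>x. (x, x)), Comp = (\<lambda>g f. (fst f, snd g))\<rparr>"

definition disjoint_union :: "('o, 'a) cat list \<Rightarrow> (nat \<times> 'o, nat \<times> 'a) cat" where
  "disjoint_union Gs =
     \<lparr>Obj = (SIGMA i : {..<length Gs}. Obj (Gs ! i)),
      Arr = (SIGMA i : {..<length Gs}. Arr (Gs ! i)),
      Dom = (\<lambda>(i, f). (i, Dom (Gs ! i) f)),
      Cod = (\<lambda>(i, f). (i, Cod (Gs ! i) f)),
      Id = (\<lambda>(i, x). (i, Id (Gs ! i) x)),
      Comp = (\<lambda>(i, g) (j, f). (i, Comp (Gs ! i) g f))\<rparr>"

section \<open>The categories \<open>CP\<^sup>*[Rel]\<close> and \<open>CPM[Rel]\<close>\<close>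

text \<open>The universe of small sets is parametrised by an infinite set \<open>K :: 'u set\<close>: a set, over
  any type, is small if its cardinality is less than that of \<open>K\<close>. If the cardinality of \<open>K\<close> is
  inaccessible, this is a Grothendieck universe up to bijection.

  Arrows are triples (domain, relation, codomain).\<close>

definition small :: "'u set \<Rightarrow> 'a set \<Rightarrow> bool" where
  "small K A \<longleftrightarrow> A \<prec> K"

definition cpstar_relation ::
  "('o, 'a) cat \<Rightarrow> ('o, 'a) cat \<Rightarrow> ('a \<times> 'a) set \<Rightarrow> bool" where
  "cpstar_relation G H R \<longleftrightarrow> R \<subseteq> Arr G \<times> Arr H \<and>
     (\<forall>(g, h) \<in> R. (Inv G g, Inv H h) \<in> R \<and> (Id G (Dom G g), Id H (Dom H h)) \<in> R)"

text \<open>The objects and morphisms of the small groupoids are drawn from the types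
  \<open>nat \<times> 'u\<close> and \<open>nat \<times> 'u \<times> 'u\<close>. As \<open>K \<subseteq> 'u\<close> is infinite, every small groupoid over any types
  is isomorphic to one over these, and they accommodate the disjoint union of the indiscrete
  groupoids on a list of subsets of \<open>'u\<close> without coding.\<close>

type_synonym 'u gpd = "(nat \<times> 'u, nat \<times> 'u \<times> 'u) cat"
type_synonym 'u cpstar_arr =
  "'u gpd \<times> ((nat \<times> 'u \<times> 'u) \<times> (nat \<times> 'u \<times> 'u)) set \<times> 'u gpd"

definition CPstar_Rel :: "'u set \<Rightarrow> ('u gpd, 'u cpstar_arr) cat" where
  "CPstar_Rel K =
    (let Ob = {G. groupoid G \<and> small K (Obj G) \<and> small K (Arr G)} in
     \<lparr>Obj = Ob,
      Arr = {(G, R, H). G \<in> Ob \<and> H \<in> Ob \<and> cpstar_relation G H R},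
      Dom = (\<lambda>(G, R, H). G),
      Cod = (\<lambda>(G, R, H). H),
      Id = (\<lambda>G. (G, Id_on (Arr G), G)),
      Comp = (\<lambda>(H', S, L) (G, R, H). (G, R O S, L))\<rparr>)"

definition cpm_relation ::
  "'x set \<Rightarrow> 'x set \<Rightarrow> (('x \<times> 'x) \<times> ('x \<times> 'x)) set \<Rightarrow> bool" where
  "cpm_relation X Y R \<longleftrightarrow> R \<subseteq> (X \<times> X) \<times> (Y \<times> Y) \<and>
     (\<forall>((x, x'), (y, y')) \<in> R. ((x', x), (y', y)) \<in> R \<and> ((x, x), (y, y)) \<in> R)"

record ('o, 'a) cmon_cat = "('o, 'a) cat" +
  Zero :: "'o \<Rightarrow> 'o \<Rightarrow> 'a"
  Plus :: "'a \<Rightarrow> 'a \<Rightarrow> 'a"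

type_synonym 'u cpm_arr = "'u set \<times> (('u \<times> 'u) \<times> ('u \<times> 'u)) set \<times> 'u set"

definition CPM_Rel :: "'u set \<Rightarrow> ('u set, 'u cpm_arr) cmon_cat" where
  "CPM_Rel K =
    (let Ob = {X. small K X} in
     \<lparr>Obj = Ob,
      Arr = {(X, R, Y). X \<in> Ob \<and> Y \<in> Ob \<and> cpm_relation X Y R},
      Dom = (\<lambda>(X, R, Y). X),
      Cod = (\<lambda>(X, R, Y). Y),
      Id = (\<lambda>X. (X, Id_on (X \<times> X), X)),
      Comp = (\<lambda>(Y', S, Z) (X, R, Y). (X, R O S, Z)),
      Zero = (\<lambda>X Y. (X, {}, Y)),
      Plus = (\<lambda>(X, R, Y) (X', S, Y'). (X, R \<union> S, Y))\<rparr>)"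

section \<open>The biproduct completion and the canonical functor\<close>

text \<open>The entry of a matrix \<open>Xs \<rightarrow> Ys\<close> in row \<open>j\<close> and column \<open>i\<close> is an arrow
  \<open>Xs ! i \<rightarrow> Ys ! j\<close>, so that composition is the usual product of matrices.\<close>

definition arr_sum :: "('o, 'a, 'z) cmon_cat_scheme \<Rightarrow> 'o \<Rightarrow> 'o \<Rightarrow> 'a list \<Rightarrow> 'a" where
  "arr_sum C A B fs = foldr (Plus C) fs (Zero C A B)"

definition biproduct_completion ::
  "('o, 'a, 'z) cmon_cat_scheme \<Rightarrow> ('o list, 'o list \<times> 'a mat \<times> 'o list) cat" where
  "biproduct_completion C =
     \<lparr>Obj = lists (Obj C),
      Arr = {(Xs, M, Ys). Xs \<in> lists (Obj C) \<and> Ys \<in> lists (Obj C) \<and>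
               M \<in> carrier_mat (length Ys) (length Xs) \<and>
               (\<forall>j < length Ys. \<forall>i < length Xs. M $$ (j, i) \<in> Hom C (Xs ! i) (Ys ! j))},
      Dom = (\<lambda>(Xs, M, Ys). Xs),
      Cod = (\<lambda>(Xs, M, Ys). Ys),
      Id = (\<lambda>Xs. (Xs,
               mat (length Xs) (length Xs)
                 (\<lambda>(j, i). if i = j then Id C (Xs ! i) else Zero C (Xs ! i) (Xs ! j)),
               Xs)),
      Comp = (\<lambda>(Ys', N, Zs) (Xs, M, Ys). (Xs,
               mat (length Zs) (length Xs)
                 (\<lambda>(k, i). arr_sum C (Xs ! i) (Zs ! k)
                    (map (\<lambda>j. Comp C (N $$ (k, j)) (M $$ (j, i))) [0..<length Ys])),
               Zs))\<rparr>"

definition rel_of :: "'x \<times> 'r \<times> 'y \<Rightarrow> 'r" where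
  "rel_of = (\<lambda>(X, R, Y). R)"

definition canonical_functor ::
  "('u set list, 'u set list \<times> 'u cpm_arr mat \<times> 'u set list, 'u gpd, 'u cpstar_arr) func" where
  "canonical_functor =
    (let T = (\<lambda>Xs. disjoint_union (map indiscrete Xs)) in
     \<lparr>OMap = T,
      AMap = (\<lambda>(Xs, M, Ys). (T Xs,
                {((i, g), (j, h)) | i g j h. i < length Xs \<and> j < length Ys \<and>
                   (g, h) \<in> rel_of (M $$ (j, i))},
                T Ys))\<rparr>)"

end

theory Submission
  imports Defs
begin

text \<open>An equivalence preserves the cardinality of endomorphism sets. In \<open>CP\<^sup>*[Rel]\<close> the group
  \<open>\<int>/2\<close> has finitely many endomorphisms: at least three, and fewer than sixteen because every
  nonempty one relates the unit to itself. The canonical functor is full and faithful, so an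
  endomorphism set of \<open>CPM[Rel]\<^sup>\<oplus>\<close> is that of a disjoint union of indiscrete groupoids. If this has
  two distinct objects, the \<open>2\<^sup>4\<close> relations between their identities are endomorphisms;
  otherwise it has at most one morphism and hence at most two endomorphisms. This works for every
  infinite \<open>K\<close>, even when only finite sets are small.\<close>

section \<open>Categories\<close>

lemma (in category) inverse_arrows_unique:
  assumes "inverse_arrows C f g" "inverse_arrows C f g'"
  shows "g = g'"
proof -
  have "g = Comp C g (Comp C f g')"
    using assms Comp_Id_right[of g] by (auto simp: inverse_arrows_def Hom_def)
  also have "\<dots> = Comp C (Comp C g f) g'"
    using assms by (intro Comp_assoc) (auto simp: inverse_arrows_def Hom_def)
  also have "\<dots> = g'"
    using assms Comp_Id_left[of g'] by (auto simp: inverse_arrows_def Hom_def)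
  finally show ?thesis .
qed

text \<open>\<open>Inv\<close> is a definite description, so uniqueness of inverses is what gives it
  a value.\<close>

lemma (in category) Inv_eq:
  "inverse_arrows C f g \<Longrightarrow> Inv C f = g"
  unfolding Inv_def by (blast intro: inverse_arrows_unique)

lemma (in category) Inv_Id:
  assumes "A \<in> Obj C"
  shows "Inv C (Id C A) = Id C A"
proof (rule Inv_eq)
  show "inverse_arrows C (Id C A) (Id C A)"
    using Id_in_Hom[OF assms] Comp_Id_left[of "Id C A"]
    by (auto simp: inverse_arrows_def Hom_def)
qed

lemma (in category) Comp_HomI:
  assumes "f \<in> Hom C A B" "g \<in> Hom C B D"
  shows "Comp C g f \<in> Hom C A D"
  using assms Comp_in_Hom[of f g] by (auto simp: Hom_def)

lemma (in category) Comp_assoc_Hom: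
  assumes "f \<in> Hom C A B" "g \<in> Hom C B D" "h \<in> Hom C D E"
  shows "Comp C h (Comp C g f) = Comp C (Comp C h g) f"
  using assms Comp_assoc[of f g h] by (auto simp: Hom_def)

text \<open>Composing with a right inverse \<open>s\<close> of \<open>t\<close> recovers
  \<open>f\<close> and \<open>g\<close> from their composites with \<open>t\<close>.\<close>

lemma (in category) iso_epi:
  assumes t: "t \<in> Hom C A B" "iso_arrow C t"
    and fg: "f \<in> Hom C B D" "g \<in> Hom C B D"
    and eq: "Comp C f t = Comp C g t"
  shows "f = g"
proof -
  obtain s where s: "s \<in> Hom C B A" "Comp C t s = Id C B"
    using t by (auto simp: iso_arrow_def inverse_arrows_def Hom_def)
  have *: "h = Comp C (Comp C h t) s" if "h \<in> Hom C B D" for h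
    using Comp_assoc_Hom[OF s(1) t(1) that] s(2) that Comp_Id_right[of h] by (simp add: Hom_def)
  show ?thesis
    using *[OF fg(1)] *[OF fg(2)] eq by simp
qed

lemma (in category) iso_mono:
  assumes t: "t \<in> Hom C A B" "iso_arrow C t"
    and fg: "f \<in> Hom C D A" "g \<in> Hom C D A"
    and eq: "Comp C t f = Comp C t g"
  shows "f = g"
proof -
  obtain s where s: "s \<in> Hom C B A" "Comp C s t = Id C A"
    using t by (auto simp: iso_arrow_def inverse_arrows_def Hom_def)
  have *: "h = Comp C s (Comp C t h)" if "h \<in> Hom C D A" for h
    using Comp_assoc_Hom[OF that t(1) s(1)] s(2) that Comp_Id_left[of h] by (simp add: Hom_def)
  show ?thesis
    using *[OF fg(1)] *[OF fg(2)] eq by simp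
qed

text \<open>The category laws are reflected by a faithful assignment into a category that preserves the
  operations, so the matrix calculus of the biproduct completion needs no separate treatment.\<close>

lemma category_if_faithful:
  assumes D: "category D"
    and Dom_in_Obj: "\<And>f. f \<in> Arr C \<Longrightarrow> Dom C f \<in> Obj C"
    and Cod_in_Obj: "\<And>f. f \<in> Arr C \<Longrightarrow> Cod C f \<in> Obj C"
    and Id_in_Hom: "\<And>A. A \<in> Obj C \<Longrightarrow> Id C A \<in> Hom C A A"
    and Comp_in_Hom: "\<And>f g. f \<in> Arr C \<Longrightarrow> g \<in> Arr C \<Longrightarrow> Cod C f = Dom C g \<Longrightarrow>
      Comp C g f \<in> Hom C (Dom C f) (Cod C g)"
    and Hom: "\<And>f. f \<in> Arr C \<Longrightarrow> AMap F f \<in> Hom D (OMap F (Dom C f)) (OMap F (Cod C f))"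
    and Id: "\<And>A. A \<in> Obj C \<Longrightarrow> AMap F (Id C A) = Id D (OMap F A)"
    and Comp: "\<And>f g. f \<in> Arr C \<Longrightarrow> g \<in> Arr C \<Longrightarrow> Cod C f = Dom C g \<Longrightarrow>
      AMap F (Comp C g f) = Comp D (AMap F g) (AMap F f)"
    and faithful: "faithful C F"
  shows "category C"
proof -
  have eqI: "f = g" if "f \<in> Hom C A B" "g \<in> Hom C A B" "AMap F f = AMap F g" for f g A B
  proof -
    have "A \<in> Obj C" "B \<in> Obj C"
      using that Dom_in_Obj Cod_in_Obj by (auto simp: Hom_def)
    then have "inj_on (AMap F) (Hom C A B)"
      using faithful by (simp add: faithful_def)
    then show ?thesis
      using that by (blast dest: inj_onD)
  qed
  show ?thesis
  proof
    fix f assume f: "f \<in> Arr C"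
    note ids = Id_in_Hom[OF Dom_in_Obj[OF f]] Id_in_Hom[OF Cod_in_Obj[OF f]]
    have F: "AMap F f \<in> Arr D" "Dom D (AMap F f) = OMap F (Dom C f)"
      "Cod D (AMap F f) = OMap F (Cod C f)"
      using Hom[OF f] by (auto simp: Hom_def)
    show "Comp C f (Id C (Dom C f)) = f"
    proof (rule eqI)
      show "Comp C f (Id C (Dom C f)) \<in> Hom C (Dom C f) (Cod C f)"
        using f ids Comp_in_Hom[of "Id C (Dom C f)" f] by (auto simp: Hom_def)
      show "AMap F (Comp C f (Id C (Dom C f))) = AMap F f"
        using f ids F Comp[of "Id C (Dom C f)" f] category.Comp_Id_right[OF D F(1)]
        by (auto simp: Hom_def Id Dom_in_Obj)
    qed (use f in \<open>auto simp: Hom_def\<close>)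
    show "Comp C (Id C (Cod C f)) f = f"
    proof (rule eqI)
      show "Comp C (Id C (Cod C f)) f \<in> Hom C (Dom C f) (Cod C f)"
        using f ids Comp_in_Hom[of f "Id C (Cod C f)"] by (auto simp: Hom_def)
      show "AMap F (Comp C (Id C (Cod C f)) f) = AMap F f"
        using f ids F Comp[of f "Id C (Cod C f)"] category.Comp_Id_left[OF D F(1)]
        by (auto simp: Hom_def Id Cod_in_Obj)
    qed (use f in \<open>auto simp: Hom_def\<close>)
  next
    fix f g h
    assume fgh: "f \<in> Arr C" "g \<in> Arr C" "h \<in> Arr C" "Cod C f = Dom C g" "Cod C g = Dom C h"
    have gf: "Comp C g f \<in> Hom C (Dom C f) (Cod C g)"
      and hg: "Comp C h g \<in> Hom C (Dom C g) (Cod C h)"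
      using Comp_in_Hom[OF fgh(1,2,4)] Comp_in_Hom[OF fgh(2,3,5)] by blast+
    show "Comp C h (Comp C g f) = Comp C (Comp C h g) f"
    proof (rule eqI)
      show "Comp C h (Comp C g f) \<in> Hom C (Dom C f) (Cod C h)"
        using gf fgh Comp_in_Hom[of "Comp C g f" h] by (auto simp: Hom_def)
      show "Comp C (Comp C h g) f \<in> Hom C (Dom C f) (Cod C h)"
        using hg fgh Comp_in_Hom[of f "Comp C h g"] by (auto simp: Hom_def)
      have "AMap F (Comp C h (Comp C g f)) = Comp D (AMap F h) (Comp D (AMap F g) (AMap F f))"
        using gf fgh Comp by (auto simp: Hom_def)
      also have "\<dots> = Comp D (Comp D (AMap F h) (AMap F g)) (AMap F f)"
        using fgh Hom[of f] Hom[of g] Hom[of h] by (intro category.Comp_assoc[OF D]) (auto simp: Hom_def)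
      also have "\<dots> = AMap F (Comp C (Comp C h g) f)"
        using hg fgh Comp by (auto simp: Hom_def)
      finally show "AMap F (Comp C h (Comp C g f)) = AMap F (Comp C (Comp C h g) f)" .
    qed
  qed (use Dom_in_Obj Cod_in_Obj Id_in_Hom Comp_in_Hom in auto)
qed

section \<open>Equivalences, faithfulness and hom-sets\<close>

lemma is_functor_Hom:
  assumes "is_functor C D F" "f \<in> Hom C A B"
  shows "AMap F f \<in> Hom D (OMap F A) (OMap F B)"
  using assms by (auto simp: is_functor_def Hom_def)

text \<open>By naturality, \<open>f\<close> composed with the isomorphism \<open>\<tau> A\<close>
  depends only on \<open>AMap F f\<close>, and \<open>\<tau> A\<close> cancels. The lemma serves
  both a functor and its quasi-inverse.\<close>

lemma faithful_if_left_inverse: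
  assumes F: "is_functor C D F" and G: "is_functor D C G"
    and iso: "naturally_isomorphic C C (comp_func G F) id_func"
  shows "faithful C F"
proof -
  interpret category C using F by (simp add: is_functor_def)
  obtain \<tau> where \<tau>: "\<And>A. A \<in> Obj C \<Longrightarrow> \<tau> A \<in> Hom C (OMap G (OMap F A)) A \<and> iso_arrow C (\<tau> A)"
    and nat: "\<And>f. f \<in> Arr C \<Longrightarrow>
      Comp C (\<tau> (Cod C f)) (AMap G (AMap F f)) = Comp C f (\<tau> (Dom C f))"
    using iso by (auto simp: naturally_isomorphic_def comp_func_def id_func_def)
  show ?thesis
    unfolding faithful_def
  proof (intro ballI inj_onI)
    fix A B f g
    assume A: "A \<in> Obj C" and fg: "f \<in> Hom C A B" "g \<in> Hom C A B" and eq: "AMap F f = AMap F g"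
    have "Comp C f (\<tau> A) = Comp C g (\<tau> A)"
      using nat[of f] nat[of g] fg eq by (simp add: Hom_def)
    then show "f = g"
      using iso_epi \<tau>[OF A] fg by blast
  qed
qed

text \<open>The counting argument starts from an object of \<open>D\<close>, so the quasi-inverse
  out of \<open>D\<close> is the functor to transport along.\<close>

lemma is_equivalence_inverse:
  assumes "is_equivalence C D F"
  obtains G where "is_functor D C G" "full D C G" "faithful D G"
proof -
  obtain G where F: "is_functor C D F" and G: "is_functor D C G"
    and GF: "naturally_isomorphic C C (comp_func G F) id_func"
    and FG: "naturally_isomorphic D D (comp_func F G) id_func"
    using assms by (auto simp: is_equivalence_def)
  interpret D: category D using F by (simp add: is_functor_def)
  have "faithful C F"
    using F G GF by (rule faithful_if_left_inverse)
  obtain \<sigma> where \<sigma>: "\<And>A. A \<in> Obj D \<Longrightarrow> \<sigma> A \<in> Hom D (OMap F (OMap G A)) A \<and> iso_arrow D (\<sigma> A)"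
    and nat: "\<And>f. f \<in> Arr D \<Longrightarrow>
      Comp D (\<sigma> (Cod D f)) (AMap F (AMap G f)) = Comp D f (\<sigma> (Dom D f))"
    using FG by (auto simp: naturally_isomorphic_def comp_func_def id_func_def)
  have "\<exists>f\<in>Hom D A B. AMap G f = h"
    if A: "A \<in> Obj D" and B: "B \<in> Obj D" and h: "h \<in> Hom C (OMap G A) (OMap G B)" for A B h
  proof -
    have Fh: "AMap F h \<in> Hom D (OMap F (OMap G A)) (OMap F (OMap G B))"
      using is_functor_Hom[OF F h] .
    note \<sigma>A = conjunct1[OF \<sigma>[OF A]] and \<sigma>B = conjunct1[OF \<sigma>[OF B]]
    obtain s where s: "s \<in> Hom D A (OMap F (OMap G A))"
      "Comp D s (\<sigma> A) = Id D (OMap F (OMap G A))"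
      using \<sigma>[OF A] by (auto simp: iso_arrow_def inverse_arrows_def Hom_def)
    \<comment> \<open>Conjugating \<open>AMap F h\<close> by the isomorphisms
      \<open>\<sigma>\<close> forces \<open>AMap F (AMap G f) = AMap F h\<close> by naturality;
      faithfulness of \<open>F\<close> then gives \<open>AMap G f = h\<close>.\<close>
    define f where "f = Comp D (Comp D (\<sigma> B) (AMap F h)) s"
    have \<sigma>Fh: "Comp D (\<sigma> B) (AMap F h) \<in> Hom D (OMap F (OMap G A)) B"
      using D.Comp_HomI[OF Fh \<sigma>B] .
    have f: "f \<in> Hom D A B"
      unfolding f_def using D.Comp_HomI[OF s(1) \<sigma>Fh] .
    have Gf: "AMap G f \<in> Hom C (OMap G A) (OMap G B)"
      using is_functor_Hom[OF G f] .
    have "Comp D (\<sigma> B) (AMap F (AMap G f)) = Comp D f (\<sigma> A)"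
      using nat[of f] f by (simp add: Hom_def)
    also have "\<dots> = Comp D (Comp D (\<sigma> B) (AMap F h)) (Comp D s (\<sigma> A))"
      unfolding f_def using D.Comp_assoc_Hom[OF \<sigma>A s(1) \<sigma>Fh] by simp
    also have "\<dots> = Comp D (\<sigma> B) (AMap F h)"
      using D.Comp_Id_right[of "Comp D (\<sigma> B) (AMap F h)"] \<sigma>Fh s(2) by (simp add: Hom_def)
    finally have "AMap F (AMap G f) = AMap F h"
      using D.iso_mono[OF \<sigma>B] \<sigma>[OF B] is_functor_Hom[OF F Gf] Fh by blast
    moreover have "OMap G A \<in> Obj C" "OMap G B \<in> Obj C"
      using A B G by (auto simp: is_functor_def)
    ultimately have "AMap G f = h"
      using \<open>faithful C F\<close> Gf h by (auto simp: faithful_def inj_on_def)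
    then show ?thesis
      using f by blast
  qed
  then have "full D C G"
    by (simp add: full_def)
  moreover have "faithful D G"
    using G F FG by (rule faithful_if_left_inverse)
  ultimately show ?thesis
    using that G by blast
qed

lemma Hom_eqpoll:
  assumes F: "is_functor C D F" "full C D F" "faithful C F" and A: "A \<in> Obj C" "B \<in> Obj C"
  shows "Hom C A B \<approx> Hom D (OMap F A) (OMap F B)"
proof -
  have "bij_betw (AMap F) (Hom C A B) (Hom D (OMap F A) (OMap F B))"
    unfolding bij_betw_def
  proof
    show "inj_on (AMap F) (Hom C A B)"
      using F A by (simp add: faithful_def)
    show "AMap F ` Hom C A B = Hom D (OMap F A) (OMap F B)"
      using is_functor_Hom[OF F(1)] F(2) A by (fastforce simp: full_def)
  qed
  then show ?thesis
    by (auto simp: eqpoll_def)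
qed

section \<open>Small sets\<close>

text \<open>This bridge makes cardinal arithmetic over \<open>card_of\<close> available for
  smallness.\<close>

lemma lesspoll_iff_card_of_ordLess: "A \<prec> B \<longleftrightarrow> ordLess2 (card_of A) (card_of B)"
  unfolding lesspoll_def lepoll_def eqpoll_iff_card_of_ordIso card_of_ordLeq
  by (auto simp: ordLeq_iff_ordLess_or_ordIso dest: not_ordLess_ordIso)

lemma small_finite: "infinite K \<Longrightarrow> finite A \<Longrightarrow> small K A"
  by (simp add: small_def finite_lesspoll_infinite)

lemma small_subset: "small K B \<Longrightarrow> A \<subseteq> B \<Longrightarrow> small K A"
  unfolding small_def by (meson lesspoll_trans1 subset_imp_lepoll)

lemma small_Un:
  assumes "infinite K" "small K A" "small K B"
  shows "small K (A \<union> B)"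
  using assms card_of_Un_ordLess_infinite
  unfolding small_def lesspoll_iff_card_of_ordLess by blast

lemma small_Plus:
  assumes "infinite K" "small K A" "small K B"
  shows "small K (A <+> B)"
  using assms card_of_Plus_ordLess_infinite
  unfolding small_def lesspoll_iff_card_of_ordLess by blast

text \<open>An infinite \<open>A <+> B\<close> is equipollent to its square, into which
  \<open>A \<times> B\<close> embeds; a finite one makes the product finite, hence smaller than
  \<open>K\<close>.\<close>

lemma small_Times:
  assumes K: "infinite K" and "small K A" "small K B"
  shows "small K (A \<times> B)"
proof (cases "finite (A <+> B)")
  case True
  then show ?thesis
    using K by (intro small_finite) auto
next
  case False
  have "A \<lesssim> A <+> B" "B \<lesssim> A <+> B"
    by (auto simp: lepoll_def intro: exI[of _ Inl] exI[of _ Inr])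
  then have "A \<times> B \<lesssim> (A <+> B) \<times> (A <+> B)"
    by (rule times_lepoll_mono)
  also have "\<dots> \<approx> A <+> B"
    using card_of_Times_same_infinite[OF False] by (simp add: eqpoll_iff_card_of_ordIso)
  also have "\<dots> \<prec> K"
    using small_Plus assms by (auto simp: small_def)
  finally show ?thesis
    by (simp add: small_def)
qed

lemma small_UN_finite:
  assumes "infinite K" "finite I" "\<And>i. i \<in> I \<Longrightarrow> small K (A i)"
  shows "small K (\<Union>i\<in>I. A i)"
  using assms(2,3) by induction (auto simp: small_finite small_Un assms(1))

text \<open>Objects of the biproduct completion are lists, so a disjoint union of indiscrete
  groupoids is a sum over a finite index set.\<close>

lemma small_Sigma_finite:
  assumes "infinite K" "finite I" "\<And>i. i \<in> I \<Longrightarrow> small K (A i)"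
  shows "small K (Sigma I A)"
proof (rule small_subset)
  show "small K (I \<times> (\<Union>i\<in>I. A i))"
    using assms by (blast intro: small_Times small_UN_finite small_finite[OF assms(1,2)])
qed auto

section \<open>\<open>CP\<^sup>*[Rel]\<close>\<close>

lemma groupoid_Inv:
  assumes "groupoid G" "f \<in> Arr G"
  shows "inverse_arrows G f (Inv G f)"
  using assms category.Inv_eq[of G f] by (auto simp: groupoid_def iso_arrow_def)

lemma cpstar_relation_Id:
  assumes "groupoid G"
  shows "cpstar_relation G G (Id_on (Arr G))"
proof -
  interpret category G using assms by (simp add: groupoid_def)
  show ?thesis
    using groupoid_Inv[OF assms] Id_in_Hom Dom_in_Obj
    by (auto simp: cpstar_relation_def Id_on_def inverse_arrows_def Hom_def)
qed

text \<open>If \<open>h\<close> links \<open>g\<close> to \<open>l\<close>, then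
  \<open>Inv H h\<close> and \<open>Id H (Dom H h)\<close> link the inverses and the
  identities.\<close>

lemma cpstar_relation_comp:
  "cpstar_relation G H R \<Longrightarrow> cpstar_relation H L S \<Longrightarrow> cpstar_relation G L (R O S)"
  unfolding cpstar_relation_def by fast

lemma Obj_CPstar: "G \<in> Obj (CPstar_Rel K) \<longleftrightarrow> groupoid G \<and> small K (Obj G) \<and> small K (Arr G)"
  by (simp add: CPstar_Rel_def)

text \<open>The form as an image lets hom-sets be counted by their relations.\<close>

lemma Hom_CPstar:
  assumes "G \<in> Obj (CPstar_Rel K)" "H \<in> Obj (CPstar_Rel K)"
  shows "Hom (CPstar_Rel K) G H = (\<lambda>R. (G, R, H)) ` {R. cpstar_relation G H R}"
  using assms by (auto simp: Hom_def CPstar_Rel_def)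

lemma category_CPstar: "category (CPstar_Rel K)"
proof
  fix f g
  assume "f \<in> Arr (CPstar_Rel K)" "g \<in> Arr (CPstar_Rel K)"
    "Cod (CPstar_Rel K) f = Dom (CPstar_Rel K) g"
  then show "Comp (CPstar_Rel K) g f \<in> Hom (CPstar_Rel K) (Dom (CPstar_Rel K) f) (Cod (CPstar_Rel K) g)"
    by (auto simp: CPstar_Rel_def Hom_def cpstar_relation_comp)
next
  fix f
  assume "f \<in> Arr (CPstar_Rel K)"
  then obtain G R H where f: "f = (G, R, H)" and "R \<subseteq> Arr G \<times> Arr H"
    by (auto simp: CPstar_Rel_def cpstar_relation_def)
  \<comment> \<open>\<open>O\<close> composes in diagrammatic order, so the identity of the domain
    stands on the left.\<close>
  then have "Id_on (Arr G) O R = R" "R O Id_on (Arr H) = R"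
    by auto
  then show "Comp (CPstar_Rel K) f (Id (CPstar_Rel K) (Dom (CPstar_Rel K) f)) = f"
    "Comp (CPstar_Rel K) (Id (CPstar_Rel K) (Cod (CPstar_Rel K) f)) f = f"
    by (simp_all add: f CPstar_Rel_def)
qed (auto simp: CPstar_Rel_def Hom_def cpstar_relation_Id)

section \<open>Disjoint unions of indiscrete groupoids\<close>

abbreviation indiscretes :: "'x set list \<Rightarrow> (nat \<times> 'x, nat \<times> 'x \<times> 'x) cat" where
  "indiscretes Xs \<equiv> disjoint_union (map indiscrete Xs)"

lemma indiscretes_Obj: "Obj (indiscretes Xs) = (SIGMA i : {..<length Xs}. Xs ! i)"
  and indiscretes_Arr: "Arr (indiscretes Xs) = (SIGMA i : {..<length Xs}. Xs ! i \<times> Xs ! i)"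
  by (auto simp: disjoint_union_def indiscrete_def)

lemma indiscretes_simps:
  assumes "i < length Xs"
  shows "Dom (indiscretes Xs) (i, f) = (i, fst f)"
    "Cod (indiscretes Xs) (i, f) = (i, snd f)"
    "Id (indiscretes Xs) (i, x) = (i, x, x)"
    "Comp (indiscretes Xs) (i, g) (j, f) = (i, fst f, snd g)"
  using assms by (auto simp: disjoint_union_def indiscrete_def)

lemma category_indiscretes: "category (indiscretes Xs)"
  by unfold_locales (auto simp: indiscretes_Obj indiscretes_Arr indiscretes_simps Hom_def)

lemma inverse_arrows_indiscretes:
  assumes "i < length Xs" "x \<in> Xs ! i" "y \<in> Xs ! i"
  shows "inverse_arrows (indiscretes Xs) (i, x, y) (i, y, x)"
  using assms by (auto simp: inverse_arrows_def Hom_def indiscretes_Arr indiscretes_simps)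

text \<open>This swap turns the inverse condition of \<open>cpstar_relation\<close> into the
  symmetry condition of \<open>cpm_relation\<close>.\<close>

lemma Inv_indiscretes:
  assumes "i < length Xs" "x \<in> Xs ! i" "y \<in> Xs ! i"
  shows "Inv (indiscretes Xs) (i, x, y) = (i, y, x)"
  using category.Inv_eq[OF category_indiscretes inverse_arrows_indiscretes[OF assms]] .

lemma groupoid_indiscretes: "groupoid (indiscretes Xs)"
  using category_indiscretes inverse_arrows_indiscretes
  by (fastforce simp: groupoid_def iso_arrow_def indiscretes_Arr)

lemma indiscretes_in_Obj_CPstar:
  assumes "infinite K" "\<And>X. X \<in> set Xs \<Longrightarrow> small K X"
  shows "indiscretes Xs \<in> Obj (CPstar_Rel K)"
  unfolding Obj_CPstar indiscretes_Obj indiscretes_Arr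
  using assms by (auto simp: groupoid_indiscretes intro!: small_Sigma_finite small_Times)

section \<open>The canonical functor\<close>

abbreviation CPM_sum :: "'u set \<Rightarrow> ('u set list, 'u set list \<times> 'u cpm_arr mat \<times> 'u set list) cat" where
  "CPM_sum K \<equiv> biproduct_completion (CPM_Rel K)"

lemma rel_of_simp [simp]: "rel_of (X, R, Y) = R"
  by (simp add: rel_of_def)

lemma Hom_CPM:
  "f \<in> Hom (CPM_Rel K) X Y \<longleftrightarrow>
     small K X \<and> small K Y \<and> (\<exists>R. f = (X, R, Y) \<and> cpm_relation X Y R)"
  by (auto simp: CPM_Rel_def Hom_def)

text \<open>Forgetting the endpoints allows composites to be computed without typing
  conditions.\<close>

lemma rel_of_Comp: "rel_of (Comp (CPM_Rel K) g f) = rel_of f O rel_of g"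
  by (auto simp: CPM_Rel_def rel_of_def split: prod.splits)

lemma rel_of_arr_sum: "rel_of (arr_sum (CPM_Rel K) A B fs) = (\<Union>f\<in>set fs. rel_of f)"
  by (induction fs) (auto simp: arr_sum_def CPM_Rel_def rel_of_def split: prod.splits)

text \<open>CPM relations contain the empty relation and are closed under union. Smallness of
  \<open>X\<close> and \<open>Y\<close> is assumed for the empty sum, where no summand supplies
  it.\<close>

lemma arr_sum_in_Hom:
  assumes "small K X" "small K Y" "\<And>f. f \<in> set fs \<Longrightarrow> f \<in> Hom (CPM_Rel K) X Y"
  shows "arr_sum (CPM_Rel K) X Y fs \<in> Hom (CPM_Rel K) X Y"
  using assms(3)
proof (induction fs)
  case Nil
  then show ?case
    using assms(1,2) by (simp add: arr_sum_def Hom_CPM) (simp add: CPM_Rel_def cpm_relation_def)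
next
  case (Cons f fs)
  then have "f \<in> Hom (CPM_Rel K) X Y" "arr_sum (CPM_Rel K) X Y fs \<in> Hom (CPM_Rel K) X Y"
    by simp_all
  then obtain R S where "f = (X, R, Y)" "cpm_relation X Y R"
    "arr_sum (CPM_Rel K) X Y fs = (X, S, Y)" "cpm_relation X Y S"
    unfolding Hom_CPM by blast
  then have "arr_sum (CPM_Rel K) X Y (f # fs) = (X, R \<union> S, Y)" "cpm_relation X Y (R \<union> S)"
    by (simp_all add: arr_sum_def CPM_Rel_def) (auto simp: cpm_relation_def)
  then show ?case
    using assms(1,2) by (simp add: Hom_CPM)
qed

lemma Comp_CPM_in_Hom:
  assumes "f \<in> Hom (CPM_Rel K) X Y" "g \<in> Hom (CPM_Rel K) Y Z"
  shows "Comp (CPM_Rel K) g f \<in> Hom (CPM_Rel K) X Z"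
proof -
  obtain R S where "f = (X, R, Y)" "cpm_relation X Y R" "g = (Y, S, Z)" "cpm_relation Y Z S"
    using assms by (auto simp: Hom_CPM)
  moreover from this have "cpm_relation X Z (R O S)"
    unfolding cpm_relation_def by fast
  ultimately have "Comp (CPM_Rel K) g f = (X, R O S, Z)" "cpm_relation X Z (R O S)"
    by (simp_all add: CPM_Rel_def)
  then show ?thesis
    using assms by (simp add: Hom_CPM)
qed

section \<open>Matrices as arrows of the biproduct completion\<close>

lemma Obj_CPM_sum: "Xs \<in> Obj (CPM_sum K) \<longleftrightarrow> (\<forall>X\<in>set Xs. small K X)"
  by (auto simp: biproduct_completion_def CPM_Rel_def)

lemma Arr_CPM_sum:
  "(Xs, M, Ys) \<in> Arr (CPM_sum K) \<longleftrightarrow> Xs \<in> Obj (CPM_sum K) \<and> Ys \<in> Obj (CPM_sum K) \<and>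
     M \<in> carrier_mat (length Ys) (length Xs) \<and>
     (\<forall>j < length Ys. \<forall>i < length Xs. M $$ (j, i) \<in> Hom (CPM_Rel K) (Xs ! i) (Ys ! j))"
  by (auto simp: biproduct_completion_def)

lemma Dom_CPM_sum: "Dom (CPM_sum K) (Xs, M, Ys) = Xs"
  and Cod_CPM_sum: "Cod (CPM_sum K) (Xs, M, Ys) = Ys"
  by (simp_all add: biproduct_completion_def)

lemma Hom_CPM_sum:
  "f \<in> Hom (CPM_sum K) Xs Ys \<longleftrightarrow> (\<exists>M. f = (Xs, M, Ys) \<and> (Xs, M, Ys) \<in> Arr (CPM_sum K))"
  by (cases f) (auto simp: Hom_def Dom_CPM_sum Cod_CPM_sum)

lemma Id_CPM_sum_in_Hom:
  assumes "Xs \<in> Obj (CPM_sum K)"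
  shows "Id (CPM_sum K) Xs \<in> Hom (CPM_sum K) Xs Xs"
proof -
  have "Id (CPM_Rel K) (Xs ! i) \<in> Hom (CPM_Rel K) (Xs ! i) (Xs ! i)" if "i < length Xs" for i
    using that assms by (auto simp: Hom_CPM Obj_CPM_sum) (auto simp: CPM_Rel_def cpm_relation_def)
  moreover have "Zero (CPM_Rel K) (Xs ! i) (Xs ! j) \<in> Hom (CPM_Rel K) (Xs ! i) (Xs ! j)"
    if "i < length Xs" "j < length Xs" for i j
    using that assms by (auto simp: Hom_CPM Obj_CPM_sum) (auto simp: CPM_Rel_def cpm_relation_def)
  ultimately show ?thesis
    using assms unfolding Hom_CPM_sum
    by (simp add: Arr_CPM_sum) (simp add: biproduct_completion_def)
qed

lemma Comp_CPM_sum_in_Hom: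
  assumes f: "f \<in> Hom (CPM_sum K) Xs Ys" and g: "g \<in> Hom (CPM_sum K) Ys Zs"
  shows "Comp (CPM_sum K) g f \<in> Hom (CPM_sum K) Xs Zs"
proof -
  obtain M N where fg: "f = (Xs, M, Ys)" "g = (Ys, N, Zs)"
    and MN: "(Xs, M, Ys) \<in> Arr (CPM_sum K)" "(Ys, N, Zs) \<in> Arr (CPM_sum K)"
    using f g by (auto simp: Hom_CPM_sum)
  \<comment> \<open>\<open>P\<close> is the matrix product of \<open>N\<close> and \<open>M\<close>,
    summed over the middle index \<open>j\<close>.\<close>
  define P where "P = mat (length Zs) (length Xs)
    (\<lambda>(k, i). arr_sum (CPM_Rel K) (Xs ! i) (Zs ! k)
      (map (\<lambda>j. Comp (CPM_Rel K) (N $$ (k, j)) (M $$ (j, i))) [0..<length Ys]))"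
  have "P $$ (k, i) \<in> Hom (CPM_Rel K) (Xs ! i) (Zs ! k)" if "k < length Zs" "i < length Xs" for k i
  proof -
    have "arr_sum (CPM_Rel K) (Xs ! i) (Zs ! k)
      (map (\<lambda>j. Comp (CPM_Rel K) (N $$ (k, j)) (M $$ (j, i))) [0..<length Ys])
      \<in> Hom (CPM_Rel K) (Xs ! i) (Zs ! k)"
    proof (rule arr_sum_in_Hom)
      show "small K (Xs ! i)" "small K (Zs ! k)"
        using MN that by (auto simp: Arr_CPM_sum Obj_CPM_sum)
      have "Comp (CPM_Rel K) (N $$ (k, j)) (M $$ (j, i)) \<in> Hom (CPM_Rel K) (Xs ! i) (Zs ! k)"
        if "j < length Ys" for j
        using MN that \<open>k < length Zs\<close> \<open>i < length Xs\<close>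
        by (intro Comp_CPM_in_Hom[where Y = "Ys ! j"]) (simp_all add: Arr_CPM_sum)
      then show "f \<in> Hom (CPM_Rel K) (Xs ! i) (Zs ! k)"
        if "f \<in> set (map (\<lambda>j. Comp (CPM_Rel K) (N $$ (k, j)) (M $$ (j, i))) [0..<length Ys])" for f
        using that by (auto simp del: split_paired_Ex)
    qed
    then show ?thesis
      using that by (simp add: P_def)
  qed
  moreover have "Comp (CPM_sum K) g f = (Xs, P, Zs)"
    by (simp add: fg P_def biproduct_completion_def)
  moreover have "P \<in> carrier_mat (length Zs) (length Xs)"
    by (simp add: P_def)
  ultimately show ?thesis
    using MN by (auto simp: Hom_CPM_sum Arr_CPM_sum)
qed

section \<open>Matrices of relations as block relations\<close>

lemma OMap_canonical: "OMap canonical_functor Xs = indiscretes Xs"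
  by (simp add: canonical_functor_def)

text \<open>Columns of \<open>M\<close> index the source and rows the target, hence the swapped
  indices in \<open>M $$ (j, i)\<close>.\<close>

definition matrix_relation ::
  "'x list \<Rightarrow> 'y list \<Rightarrow> ('p \<times> ('g \<times> 'h) set \<times> 'q) mat \<Rightarrow> ((nat \<times> 'g) \<times> (nat \<times> 'h)) set" where
  "matrix_relation Xs Ys M = {((i, g), (j, h)) | i g j h. i < length Xs \<and> j < length Ys \<and>
     (g, h) \<in> rel_of (M $$ (j, i))}"

lemma matrix_relation_iff:
  "((i, g), (j, h)) \<in> matrix_relation Xs Ys M \<longleftrightarrow>
     i < length Xs \<and> j < length Ys \<and> (g, h) \<in> rel_of (M $$ (j, i))"
  by (simp add: matrix_relation_def)

lemma AMap_canonical:
  "AMap canonical_functor (Xs, M, Ys) = (indiscretes Xs, matrix_relation Xs Ys M, indiscretes Ys)"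
  by (simp add: canonical_functor_def matrix_relation_def)

text \<open>A relation between disjoint unions splits into blocks, one for each pair of summands.
  Inverses and identities stay within a summand, so the closure conditions can be tested block by
  block, where they become those of \<open>cpm_relation\<close>. Both well-definedness and fullness
  of the canonical functor rest on this.\<close>

lemma cpstar_relation_indiscretes:
  "cpstar_relation (indiscretes Xs) (indiscretes Ys) R \<longleftrightarrow>
     R \<subseteq> ({..<length Xs} \<times> UNIV) \<times> ({..<length Ys} \<times> UNIV) \<and>
     (\<forall>i<length Xs. \<forall>j<length Ys. cpm_relation (Xs ! i) (Ys ! j) {(g, h). ((i, g), (j, h)) \<in> R})"
  (is "?L \<longleftrightarrow> ?R")
proof
  assume L: ?L
  show ?R
  proof (intro conjI allI impI)
    show "R \<subseteq> ({..<length Xs} \<times> UNIV) \<times> ({..<length Ys} \<times> UNIV)"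
      using L by (auto simp: cpstar_relation_def indiscretes_Arr)
    fix i j assume ij: "i < length Xs" "j < length Ys"
    have sub: "x \<in> Xs ! i \<and> x' \<in> Xs ! i \<and> y \<in> Ys ! j \<and> y' \<in> Ys ! j"
      if "((i, x, x'), (j, y, y')) \<in> R" for x x' y y'
      using L that by (auto simp: cpstar_relation_def indiscretes_Arr)
    have "((i, x', x), (j, y', y)) \<in> R \<and> ((i, x, x), (j, y, y)) \<in> R"
      if "((i, x, x'), (j, y, y')) \<in> R" for x x' y y'
      using L that sub[OF that] ij unfolding cpstar_relation_def
      by (fastforce simp: Inv_indiscretes indiscretes_simps)
    with sub show "cpm_relation (Xs ! i) (Ys ! j) {(g, h). ((i, g), (j, h)) \<in> R}"
      unfolding cpm_relation_def by auto
  qed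
next
  assume R: ?R
  have ij: "i < length Xs" "j < length Ys" if "((i, g), (j, h)) \<in> R" for i g j h
    using R that by auto
  have sub: "x \<in> Xs ! i \<and> x' \<in> Xs ! i \<and> y \<in> Ys ! j \<and> y' \<in> Ys ! j \<and>
      ((i, x', x), (j, y', y)) \<in> R \<and> ((i, x, x), (j, y, y)) \<in> R"
    if "((i, x, x'), (j, y, y')) \<in> R" for i x x' j y y'
  proof -
    have "cpm_relation (Xs ! i) (Ys ! j) {(g, h). ((i, g), (j, h)) \<in> R}"
      using R ij[OF that] by blast
    with that show ?thesis
      unfolding cpm_relation_def by auto
  qed
  show ?L
    unfolding cpstar_relation_def
  proof (intro conjI ballI)
    show "R \<subseteq> Arr (indiscretes Xs) \<times> Arr (indiscretes Ys)"
      using ij sub by (fastforce simp: indiscretes_Arr)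
    fix p assume "p \<in> R"
    moreover obtain i x x' j y y' where p: "p = ((i, x, x'), (j, y, y'))"
      by (metis surj_pair)
    ultimately have in_R: "((i, x, x'), (j, y, y')) \<in> R"
      by simp
    show "case p of (g, h) \<Rightarrow> (Inv (indiscretes Xs) g, Inv (indiscretes Ys) h) \<in> R \<and>
      (Id (indiscretes Xs) (Dom (indiscretes Xs) g), Id (indiscretes Ys) (Dom (indiscretes Ys) h)) \<in> R"
      using sub[OF in_R] ij[OF in_R] by (simp add: p Inv_indiscretes indiscretes_simps)
  qed
qed

section \<open>Functoriality, fullness and faithfulness of the canonical functor\<close>

context
  fixes K :: "'u set"
  assumes K: "infinite K"
begin

lemma OMap_canonical_in_Obj:
  "Xs \<in> Obj (CPM_sum K) \<Longrightarrow> OMap canonical_functor Xs \<in> Obj (CPstar_Rel K)"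
  using indiscretes_in_Obj_CPstar[OF K] by (auto simp: Obj_CPM_sum OMap_canonical)

lemma AMap_canonical_in_Hom:
  assumes "f \<in> Hom (CPM_sum K) Xs Ys"
  shows "AMap canonical_functor f \<in>
    Hom (CPstar_Rel K) (OMap canonical_functor Xs) (OMap canonical_functor Ys)"
proof -
  obtain M where f: "f = (Xs, M, Ys)" and M: "(Xs, M, Ys) \<in> Arr (CPM_sum K)"
    using assms by (auto simp: Hom_CPM_sum)
  have "cpm_relation (Xs ! i) (Ys ! j) (rel_of (M $$ (j, i)))"
    if "i < length Xs" "j < length Ys" for i j
  proof -
    have "M $$ (j, i) \<in> Hom (CPM_Rel K) (Xs ! i) (Ys ! j)"
      using M that by (simp add: Arr_CPM_sum)
    then show ?thesis
      by (auto simp: Hom_CPM)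
  qed
  then have "cpstar_relation (indiscretes Xs) (indiscretes Ys) (matrix_relation Xs Ys M)"
    unfolding cpstar_relation_indiscretes
    by (auto simp: matrix_relation_iff)
  moreover have "indiscretes Xs \<in> Obj (CPstar_Rel K)" "indiscretes Ys \<in> Obj (CPstar_Rel K)"
    using M OMap_canonical_in_Obj by (auto simp: Arr_CPM_sum OMap_canonical)
  ultimately show ?thesis
    by (simp add: f AMap_canonical OMap_canonical Hom_CPstar)
qed

text \<open>The preimage of a relation is its matrix of blocks. Nothing is lost, because
  \<open>R\<close> has no pair with an index out of range.\<close>

lemma full_canonical: "full (CPM_sum K) (CPstar_Rel K) canonical_functor"
  unfolding full_def
proof (intro ballI)
  fix Xs Ys f
  assume Xs: "Xs \<in> Obj (CPM_sum K)" and Ys: "Ys \<in> Obj (CPM_sum K)"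
    and "f \<in> Hom (CPstar_Rel K) (OMap canonical_functor Xs) (OMap canonical_functor Ys)"
  then obtain R where f: "f = (indiscretes Xs, R, indiscretes Ys)"
    and R: "cpstar_relation (indiscretes Xs) (indiscretes Ys) R"
    using Hom_CPstar[OF OMap_canonical_in_Obj[OF Xs] OMap_canonical_in_Obj[OF Ys]]
    by (auto simp: OMap_canonical)
  define M where "M = mat (length Ys) (length Xs)
    (\<lambda>(j, i). (Xs ! i, {(g, h). ((i, g), (j, h)) \<in> R}, Ys ! j))"
  have "(Xs, M, Ys) \<in> Hom (CPM_sum K) Xs Ys"
    using Xs Ys R unfolding cpstar_relation_indiscretes
    by (auto simp: Hom_CPM_sum Arr_CPM_sum M_def Hom_CPM Obj_CPM_sum)
  moreover have "matrix_relation Xs Ys M = R"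
    using R unfolding cpstar_relation_indiscretes
    by (auto simp: matrix_relation_def M_def)
  ultimately show "\<exists>f'\<in>Hom (CPM_sum K) Xs Ys. AMap canonical_functor f' = f"
    using f by (metis AMap_canonical)
qed

text \<open>Each entry is a triple whose endpoints are fixed by its position, so the blocks of the
  relation determine the matrix.\<close>

lemma faithful_canonical: "faithful (CPM_sum K) canonical_functor"
  unfolding faithful_def
proof (intro ballI inj_onI)
  fix Xs Ys f g
  assume "f \<in> Hom (CPM_sum K) Xs Ys" "g \<in> Hom (CPM_sum K) Xs Ys"
    and eq: "AMap canonical_functor f = AMap canonical_functor g"
  then obtain M N where fg: "f = (Xs, M, Ys)" "g = (Xs, N, Ys)"
    and MN: "(Xs, M, Ys) \<in> Arr (CPM_sum K)" "(Xs, N, Ys) \<in> Arr (CPM_sum K)"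
    by (auto simp: Hom_CPM_sum)
  have rel: "matrix_relation Xs Ys M = matrix_relation Xs Ys N"
    using eq by (simp add: fg AMap_canonical)
  have "M $$ (j, i) = N $$ (j, i)" if ij: "j < length Ys" "i < length Xs" for i j
  proof -
    have "(a, b) \<in> rel_of (M $$ (j, i)) \<longleftrightarrow> (a, b) \<in> rel_of (N $$ (j, i))" for a b
      using ij rel by (metis matrix_relation_iff)
    then have "rel_of (M $$ (j, i)) = rel_of (N $$ (j, i))"
      by auto
    moreover have "M $$ (j, i) \<in> Hom (CPM_Rel K) (Xs ! i) (Ys ! j)"
      "N $$ (j, i) \<in> Hom (CPM_Rel K) (Xs ! i) (Ys ! j)"
      using MN ij by (auto simp: Arr_CPM_sum)
    ultimately show ?thesis
      by (auto simp: Hom_CPM)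
  qed
  then have "M = N"
    using MN by (intro eq_matI) (auto simp: Arr_CPM_sum)
  then show "f = g"
    by (simp add: fg)
qed

text \<open>Zeros off the diagonal contribute no pairs, and the diagonal blocks make up the identity
  relation.\<close>

lemma AMap_canonical_Id:
  assumes "Xs \<in> Obj (CPM_sum K)"
  shows "AMap canonical_functor (Id (CPM_sum K) Xs) =
    Id (CPstar_Rel K) (OMap canonical_functor Xs)"
proof -
  define I where "I = mat (length Xs) (length Xs)
    (\<lambda>(j, i). if i = j then Id (CPM_Rel K) (Xs ! i) else Zero (CPM_Rel K) (Xs ! i) (Xs ! j))"
  have "rel_of (I $$ (j, i)) = (if i = j then Id_on (Xs ! i \<times> Xs ! i) else {})"
    if "i < length Xs" "j < length Xs" for i j
    using that by (simp add: I_def CPM_Rel_def)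
  then have "matrix_relation Xs Xs I = Id_on (Arr (indiscretes Xs))"
    by (auto simp: matrix_relation_def indiscretes_Arr split: if_splits)
  moreover have "Id (CPM_sum K) Xs = (Xs, I, Xs)"
    by (simp add: biproduct_completion_def I_def)
  ultimately show ?thesis
    by (simp add: AMap_canonical OMap_canonical) (simp add: CPstar_Rel_def)
qed

text \<open>A middle element of the relational composite is an index \<open>j\<close> with a middle
  element of block \<open>j\<close>; the union over \<open>j\<close> is the sum in the matrix
  product.\<close>

lemma AMap_canonical_Comp:
  assumes "f \<in> Hom (CPM_sum K) Xs Ys" "g \<in> Hom (CPM_sum K) Ys Zs"
  shows "AMap canonical_functor (Comp (CPM_sum K) g f) =
    Comp (CPstar_Rel K) (AMap canonical_functor g) (AMap canonical_functor f)"
proof -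
  obtain M N where fg: "f = (Xs, M, Ys)" "g = (Ys, N, Zs)"
    using assms by (auto simp: Hom_CPM_sum)
  define P where "P = mat (length Zs) (length Xs)
    (\<lambda>(k, i). arr_sum (CPM_Rel K) (Xs ! i) (Zs ! k)
      (map (\<lambda>j. Comp (CPM_Rel K) (N $$ (k, j)) (M $$ (j, i))) [0..<length Ys]))"
  have "rel_of (P $$ (k, i)) = (\<Union>j<length Ys. rel_of (M $$ (j, i)) O rel_of (N $$ (k, j)))"
    if "k < length Zs" "i < length Xs" for k i
    using that by (auto simp: P_def rel_of_arr_sum rel_of_Comp)
  then have "matrix_relation Xs Zs P = matrix_relation Xs Ys M O matrix_relation Ys Zs N"
    by (auto simp: matrix_relation_def relcomp_unfold) fastforce+
  moreover have "Comp (CPM_sum K) g f = (Xs, P, Zs)"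
    by (simp add: fg P_def biproduct_completion_def)
  ultimately show ?thesis
    by (simp add: fg AMap_canonical) (simp add: CPstar_Rel_def)
qed

lemma is_functor_canonical: "is_functor (CPM_sum K) (CPstar_Rel K) canonical_functor"
proof -
  have Hom: "f \<in> Hom (CPM_sum K) (Dom (CPM_sum K) f) (Cod (CPM_sum K) f)"
    if "f \<in> Arr (CPM_sum K)" for f
    using that by (simp add: Hom_def)
  have Comp: "AMap canonical_functor (Comp (CPM_sum K) g f) =
      Comp (CPstar_Rel K) (AMap canonical_functor g) (AMap canonical_functor f)"
    if "f \<in> Arr (CPM_sum K)" "g \<in> Arr (CPM_sum K)" "Cod (CPM_sum K) f = Dom (CPM_sum K) g" for f g
    using AMap_canonical_Comp[OF Hom[OF that(1), unfolded that(3)] Hom[OF that(2)]] .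
  have "category (CPM_sum K)"
  \<comment> \<open>No circularity arises: faithfulness and preservation of the operations were
    shown without the category laws of the source.\<close>
  proof (rule category_if_faithful[OF category_CPstar])
    fix f assume f: "f \<in> Arr (CPM_sum K)"
    show "Dom (CPM_sum K) f \<in> Obj (CPM_sum K)" "Cod (CPM_sum K) f \<in> Obj (CPM_sum K)"
      using f by (cases f; auto simp: Arr_CPM_sum Dom_CPM_sum Cod_CPM_sum)+
    show "AMap canonical_functor f \<in> Hom (CPstar_Rel K) (OMap canonical_functor (Dom (CPM_sum K) f))
        (OMap canonical_functor (Cod (CPM_sum K) f))"
      using AMap_canonical_in_Hom[OF Hom[OF f]] .
  next
    fix f g
    assume fg: "f \<in> Arr (CPM_sum K)" "g \<in> Arr (CPM_sum K)" "Cod (CPM_sum K) f = Dom (CPM_sum K) g"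
    show "Comp (CPM_sum K) g f \<in> Hom (CPM_sum K) (Dom (CPM_sum K) f) (Cod (CPM_sum K) g)"
      using Comp_CPM_sum_in_Hom[OF Hom[OF fg(1), unfolded fg(3)] Hom[OF fg(2)]] .
  qed (use Id_CPM_sum_in_Hom AMap_canonical_Id Comp faithful_canonical in auto)
  then show ?thesis
    unfolding is_functor_def
    using category_CPstar OMap_canonical_in_Obj AMap_canonical_in_Hom[OF Hom] AMap_canonical_Id Comp
    by blast
qed

end

section \<open>Counting endomorphisms\<close>

text \<open>The group of order two as a groupoid with one object. The first coordinate of an arrow
  is the group element; \<open>u\<close> fills the other coordinates of the fixed types.\<close>

definition cyclic2 :: "'u \<Rightarrow> 'u gpd" where
  "cyclic2 u = \<lparr>Obj = {(0, u)}, Arr = {0, 1} \<times> {(u, u)}, Dom = (\<lambda>_. (0, u)), Cod = (\<lambda>_. (0, u)),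
     Id = (\<lambda>_. (0, u, u)), Comp = (\<lambda>g f. ((fst g + fst f) mod 2, u, u))\<rparr>"

lemma category_cyclic2: "category (cyclic2 u)"
  by unfold_locales (auto simp: cyclic2_def Hom_def)

lemma inverse_arrows_cyclic2:
  "f \<in> Arr (cyclic2 u) \<Longrightarrow> inverse_arrows (cyclic2 u) f f"
  by (auto simp: inverse_arrows_def Hom_def cyclic2_def)

lemma Inv_cyclic2: "f \<in> Arr (cyclic2 u) \<Longrightarrow> Inv (cyclic2 u) f = f"
  using category.Inv_eq[OF category_cyclic2 inverse_arrows_cyclic2] .

lemma cyclic2_in_Obj_CPstar:
  assumes "infinite K"
  shows "cyclic2 u \<in> Obj (CPstar_Rel K)"
proof -
  have "groupoid (cyclic2 u)"
    using category_cyclic2 inverse_arrows_cyclic2 by (fastforce simp: groupoid_def iso_arrow_def)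
  moreover have "finite (Obj (cyclic2 u))" "finite (Arr (cyclic2 u))"
    by (simp_all add: cyclic2_def)
  ultimately show ?thesis
    using assms by (simp add: Obj_CPstar small_finite)
qed

text \<open>Each group element is its own inverse, so the inverse condition is automatic, and every
  identity is the unit.\<close>

lemma cpstar_relation_cyclic2:
  "cpstar_relation (cyclic2 u) (cyclic2 u) R \<longleftrightarrow>
     R \<subseteq> Arr (cyclic2 u) \<times> Arr (cyclic2 u) \<and> (R \<noteq> {} \<longrightarrow> ((0, u, u), (0, u, u)) \<in> R)"
proof -
  have "(Inv (cyclic2 u) (fst p), Inv (cyclic2 u) (snd p)) = p"
    if "p \<in> Arr (cyclic2 u) \<times> Arr (cyclic2 u)" for p
    using that by (simp add: mem_Times_iff Inv_cyclic2)
  moreover have "Id (cyclic2 u) A = (0, u, u)" for A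
    by (simp add: cyclic2_def)
  ultimately show ?thesis
    unfolding cpstar_relation_def case_prod_unfold by auto
qed

text \<open>The exact number is 9: the empty relation and the 8 relations containing the pair of
  units. The bounds suffice for the comparison.\<close>

lemma End_cyclic2_bounds:
  fixes u :: 'u
  defines "E \<equiv> {R. cpstar_relation (cyclic2 u) (cyclic2 u) R}"
  shows "finite E" "2 < card E" "card E < 16"
proof -
  let ?e = "(0, u, u) :: nat \<times> 'u \<times> 'u" and ?s = "(1, u, u) :: nat \<times> 'u \<times> 'u"
  have A: "Arr (cyclic2 u) = {?e, ?s}"
    by (auto simp: cyclic2_def)
  let ?P = "Pow ({?e, ?s} \<times> {?e, ?s})"
  have P: "finite ?P" "card ?P = 16"
    by (simp_all add: card_Pow card_cartesian_product)
  have "E \<subset> ?P"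
  proof
    show "E \<subseteq> ?P"
      unfolding E_def cpstar_relation_cyclic2 A by blast
    \<comment> \<open>A nonempty relation omitting the pair of units makes the inclusion
      strict.\<close>
    have "{(?s, ?s)} \<in> ?P" "{(?s, ?s)} \<notin> E"
      by (simp_all add: E_def cpstar_relation_cyclic2)
    then show "E \<noteq> ?P"
      by blast
  qed
  then show "finite E" "card E < 16"
    using P psubset_card_mono[of ?P E] finite_subset[of E ?P] by auto
  have "card {{}, {(?e, ?e)}, {?e, ?s} \<times> {?e, ?s}} \<le> card E"
    using \<open>finite E\<close> by (rule card_mono) (auto simp: E_def cpstar_relation_cyclic2 A)
  moreover have "{(?e, ?e)} \<noteq> {?e, ?s} \<times> {?e, ?s}"
    by auto
  ultimately show "2 < card E"
    by simp
qed

text \<open>An identity is its own inverse and the identity of its domain, so any set of pairs of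
  identities satisfies both closure conditions.\<close>

lemma Pow_lepoll_cpstar_relations:
  assumes G: "groupoid G" and S: "S \<subseteq> Obj G"
  shows "Pow (S \<times> S) \<lesssim> {R. cpstar_relation G G R}"
proof -
  interpret category G using G by (simp add: groupoid_def)
  let ?f = "\<lambda>p. (Id G (fst p), Id G (snd p))"
  have Id: "Id G a \<in> Arr G" "Dom G (Id G a) = a" "Inv G (Id G a) = Id G a" if "a \<in> S" for a
    using that S Id_in_Hom[of a] Inv_Id[of a] by (auto simp: Hom_def)
  \<comment> \<open>\<open>Dom G\<close> recovers an object from its identity.\<close>
  have "inj_on ?f (S \<times> S)"
    by (rule inj_onI) (metis Id(2) fst_conv mem_Times_iff prod.expand snd_conv)
  then have "inj_on ((`) ?f) (Pow (S \<times> S))"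
    by (rule inj_on_image_Pow)
  moreover have "cpstar_relation G G (?f ` U)" if "U \<subseteq> S \<times> S" for U
  proof -
    have "fst p \<in> S \<and> snd p \<in> S" if "p \<in> U" for p
      using that \<open>U \<subseteq> S \<times> S\<close> by auto
    then show ?thesis
      unfolding cpstar_relation_def by (auto simp: Id simp del: split_paired_All)
  qed
  ultimately show ?thesis
    unfolding lepoll_def by (intro exI[of _ "(`) ?f"]) auto
qed

lemma cpstar_relations_indiscretes_not_eqpoll_cyclic2:
  "\<not> {R. cpstar_relation (cyclic2 u) (cyclic2 u) R}
     \<approx> {R. cpstar_relation (indiscretes Xs) (indiscretes Xs) R}" (is "\<not> ?E \<approx> ?F")
proof
  assume eq: "?E \<approx> ?F"
  \<comment> \<open>Finiteness is transferred first, since \<open>card\<close> is 0 on infinite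
    sets.\<close>
  have fin: "finite ?F"
    using End_cyclic2_bounds(1)[of u] eqpoll_finite_iff[OF eq] by simp
  then have card: "card ?F = card ?E"
    using End_cyclic2_bounds(1)[of u] eq by (simp add: eqpoll_iff_card)
  show False
  proof (cases "\<exists>p q. p \<in> Obj (indiscretes Xs) \<and> q \<in> Obj (indiscretes Xs) \<and> p \<noteq> q")
    case True
    then obtain p q where pq: "p \<noteq> q" "{p, q} \<subseteq> Obj (indiscretes Xs)"
      by blast
    have "Pow ({p, q} \<times> {p, q}) \<lesssim> ?F"
      using groupoid_indiscretes pq(2) by (rule Pow_lepoll_cpstar_relations)
    then have "card (Pow ({p, q} \<times> {p, q})) \<le> card ?F"
      using fin by (simp add: lepoll_iff_card_le)
    moreover have "card (Pow ({p, q} \<times> {p, q})) = 16"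
      using pq(1) by (simp add: card_Pow card_cartesian_product)
    ultimately show False
      using card End_cyclic2_bounds(3)[of u] by simp
  next
    case False
    \<comment> \<open>An arrow is a summand index with two endpoints, so a single object allows only
      one arrow.\<close>
    have "p = q" if "p \<in> Arr (indiscretes Xs)" "q \<in> Arr (indiscretes Xs)" for p q
    proof -
      obtain i x y j z w where pq: "p = (i, x, y)" "q = (j, z, w)"
        by (metis surj_pair)
      have "(i, x) \<in> Obj (indiscretes Xs)" "(i, y) \<in> Obj (indiscretes Xs)"
        "(j, z) \<in> Obj (indiscretes Xs)" "(j, w) \<in> Obj (indiscretes Xs)"
        using that by (auto simp: pq indiscretes_Obj indiscretes_Arr)
      with False show ?thesis
        unfolding pq by blast
    qed
    \<comment> \<open>If there is no arrow at all, any \<open>a\<close> will do.\<close>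
    then obtain a where "Arr (indiscretes Xs) \<subseteq> {a}"
      by blast
    then have "?F \<subseteq> {{}, {(a, a)}}"
      by (auto simp: cpstar_relation_def)
    then have "card ?F \<le> card {{}, {(a, a)}}"
      by (intro card_mono) auto
    then show False
      using card End_cyclic2_bounds(2)[of u] by simp
  qed
qed

lemma no_equivalence:
  fixes K :: "'u set"
  assumes K: "infinite K"
  shows "\<not> is_equivalence (CPM_sum K) (CPstar_Rel K) F"
proof
  let ?D = "CPstar_Rel K"
  assume "is_equivalence (CPM_sum K) ?D F"
  then obtain G where G: "is_functor ?D (CPM_sum K) G" "full ?D (CPM_sum K) G" "faithful ?D G"
    by (rule is_equivalence_inverse)
  \<comment> \<open>Any element of \<open>'u\<close> serves, as smallness restricts cardinality
    only.\<close>
  let ?B = "cyclic2 (undefined :: 'u)"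
  have B: "?B \<in> Obj ?D"
    using cyclic2_in_Obj_CPstar[OF K] .
  define Xs where "Xs = OMap G ?B"
  have Xs: "Xs \<in> Obj (CPM_sum K)"
    using G B by (simp add: is_functor_def Xs_def)
  have T: "indiscretes Xs \<in> Obj ?D"
    using OMap_canonical_in_Obj[OF K Xs] by (simp add: OMap_canonical)
  have End: "{R. cpstar_relation H H R} \<approx> Hom ?D H H" if "H \<in> Obj ?D" for H
    unfolding Hom_CPstar[OF that that]
    by (intro eqpoll_sym[OF inj_on_image_eqpoll_self]) (simp add: inj_on_def)
  have "Hom ?D ?B ?B \<approx> Hom (CPM_sum K) Xs Xs"
    using Hom_eqpoll[OF G B B] by (simp add: Xs_def)
  \<comment> \<open>The canonical functor carries the count back into \<open>CPstar_Rel K\<close>,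
    where both sides count relations on groupoids.\<close>
  also have "\<dots> \<approx> Hom ?D (indiscretes Xs) (indiscretes Xs)"
    using Hom_eqpoll[OF is_functor_canonical full_canonical faithful_canonical, OF K K K Xs Xs]
    by (simp add: OMap_canonical)
  finally have "{R. cpstar_relation ?B ?B R} \<approx> {R. cpstar_relation (indiscretes Xs) (indiscretes Xs) R}"
    using End[OF B] End[OF T] by (meson eqpoll_sym eqpoll_trans)
  then show False
    by (rule notE[OF cpstar_relations_indiscretes_not_eqpoll_cyclic2])
qed

theorem mainTheorem17:
  fixes K :: "'u set"
  assumes "infinite K"
  shows "(is_functor (biproduct_completion (CPM_Rel K)) (CPstar_Rel K) canonical_functor \<and>
          full (biproduct_completion (CPM_Rel K)) (CPstar_Rel K) canonical_functor \<and>
          faithful (biproduct_completion (CPM_Rel K)) canonical_functor) \<and>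
         \<not> is_equivalence (biproduct_completion (CPM_Rel K)) (CPstar_Rel K) canonical_functor \<and>
         (\<nexists>F. is_equivalence (biproduct_completion (CPM_Rel K)) (CPstar_Rel K) F)"
  using is_functor_canonical full_canonical faithful_canonical no_equivalence assms by blast

end
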